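(* Let $(E \xrightarrow{Q} K,\gamma)$ be a projected cone with dual projected cone $(F\xrightarrow{P} N,\delta)$, and let $L := \ker(P)$. Let $\gamma_1,\gamma_2\preceq\gamma$ be faces and $\delta_i := \gamma_i^{*}$. Then the following are equivalent: (i) there is an $L$-invariant separating linear form for $\delta_1$ and $\delta_2$; (ii) $Q(\gamma_1)^{\circ}\cap Q(\gamma_2)^{\circ}\neq\emptyset$.
   Context: Lattices are finitely generated free abelian groups, $E_{\mathbb Q}:=\mathbb Q\otimes E$; cones are convex polyhedral cones, $\tau^\circ$ denotes relative interior, $\preceq$ the face relation, $\sigma^\perp$ and $\sigma^\vee$ the orthogonal space and dual cone in the dual vector space. A projected cone $(E\xrightarrow{Q}K,\gamma)$ is a surjective lattice homomorphism $Q\colon E\to K$ with a simplicial full-dimensional cone $\gamma\subset E_{\mathbb Q}$. Its dual projected cone $(F\xrightarrow{P}N,\delta)$ is defined by $M:=\ker Q$, $F:=\mathrm{Hom}(E,\mathbb Z)$, $N:=\mathrm{Hom}(M,\mathbb Z)$, $P\colon F\to N$ the restriction map, and $\delta:=\gamma^\vee\subset F_{\mathbb Q}$ (so $0\to\mathrm{Hom}(K,\mathbb Z)\to F\xrightarrow{P} N\to 0$ is exact; note $P$ is not the dual of $Q$). For a face $\gamma_0\preceq\gamma$ put $\gamma_0^{*}:=\gamma_0^\perp\cap\delta$ (this is an order-reversing bijection between faces of $\gamma$ and of $\delta$). An $L$-invariant linear form is an element $u\in E=\mathrm{Hom}(F,\mathbb Z)$ with $L\subset u^\perp$. A separating linear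 form for cones $\delta_1,\delta_2$ is a $u$ with $u|_{\delta_1}\ge 0$, $u|_{\delta_2}\le 0$ and $u^\perp\cap\delta_1=u^\perp\cap\delta_2=\delta_1\cap\delta_2$. *)

theory Defs
  imports "HOL-Analysis.Analysis"
begin

text \<open>Lattices are modelled as integer points of real coordinate spaces;
  a lattice of rank n is identified with the integer vectors in real^'n.\<close>

definition int_vecs :: "(real ^ 'n) set" where
  "int_vecs = {x. \<forall>i. x $ i \<in> \<int>}"

definition rat_vecs :: "(real ^ 'n) set" where
  "rat_vecs = {x. \<forall>i. x $ i \<in> \<rat>}"

text \<open>Cone generated by a family of vectors (nonnegative combinations).\<close>
definition gen_cone :: "('i::finite \<Rightarrow> real ^ 'n) \<Rightarrow> (real ^ 'n) set" where
  "gen_cone v = {(\<Sum>i\<in>UNIV. c i *\<^sub>R v i) | c. \<forall>i. 0 \<le> c i}"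

text \<open>Dual cone (in the dual space, identified with real^'n via the dot product).\<close>
definition dual_cone :: "(real ^ 'n) set \<Rightarrow> (real ^ 'n) set" where
  "dual_cone S = {f. \<forall>x\<in>S. 0 \<le> f \<bullet> x}"

definition orth :: "(real ^ 'n) set \<Rightarrow> (real ^ 'n) set" where
  "orth S = {f. \<forall>x\<in>S. f \<bullet> x = 0}"

text \<open>Face relation of cones: tau is a face of sigma iff tau = sigma \<inter> u^perp
  for some u in the dual cone of sigma.\<close>
definition cone_face :: "(real ^ 'n) set \<Rightarrow> (real ^ 'n) set \<Rightarrow> bool" where
  "cone_face \<tau> \<sigma> \<longleftrightarrow> (\<exists>u. u \<in> dual_cone \<sigma> \<and> \<tau> = \<sigma> \<inter> {x. u \<bullet> x = 0})"

text \<open>Face dual: gamma0^* = gamma0^perp \<inter> delta.\<close>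
definition face_star :: "(real ^ 'n) set \<Rightarrow> (real ^ 'n) set \<Rightarrow> (real ^ 'n) set" where
  "face_star \<delta> \<gamma>0 = orth \<gamma>0 \<inter> \<delta>"

text \<open>u (a linear form on F, i.e. an element of E) separates the cones d1, d2.\<close>
definition separating_form :: "real ^ 'n \<Rightarrow> (real ^ 'n) set \<Rightarrow> (real ^ 'n) set \<Rightarrow> bool" where
  "separating_form u d1 d2 \<longleftrightarrow>
     (\<forall>f\<in>d1. 0 \<le> u \<bullet> f) \<and> (\<forall>f\<in>d2. u \<bullet> f \<le> 0) \<and>
     d1 \<inter> {f. u \<bullet> f = 0} = d1 \<inter> d2 \<and> d2 \<inter> {f. u \<bullet> f = 0} = d1 \<inter> d2"

end

theory Submission
  imports Defs
begin

(* Let V be the matrix whose columns are the generators of gamma. Then gamma is the image under V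
   of the nonnegative orthant, its faces are the images of coordinate faces {c >= 0, c_j = 0 off I},
   and the dual of such a face is {f. f V >= 0, (f V)_j = 0 on I}. A form u = V c separates
   delta_1 and delta_2 exactly when c is positive on I2 - I1, negative on I1 - I2 and zero on the
   indices in neither I1 nor I2; this is the sign pattern of b - a for relative-interior points a, b
   of the two coordinate faces. An integral u is L-invariant iff Q u = 0, so both conditions say
   that ker (Q V) contains a vector with this sign pattern. Integrality is no restriction: the strict
   sign conditions are open and the rational points are dense in the rationally defined subspace
   {c. Q V c = 0, c_j = 0 off I1 and I2}, so there is a rational solution, and a positive multiple
   of it clears denominators. *)

definition coord_face :: "'n set \<Rightarrow> (real ^ 'n) set" where
  "coord_face I = {c. (\<forall>j. 0 \<le> c $ j) \<and> (\<forall>j. j \<notin> I \<longrightarrow> c $ j = 0)}"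

lemma convex_coord_face: "convex (coord_face I)"
  unfolding convex_def coord_face_def by auto

lemma affine_hull_coord_face_subset:
  "affine hull (coord_face I) \<subseteq> {c. \<forall>j. j \<notin> I \<longrightarrow> c $ j = 0}"
  by (rule hull_minimal) (auto simp: coord_face_def affine_def)

lemma rel_interior_coord_face:
  fixes I :: "'n::finite set"
  shows "rel_interior (coord_face I) =
     {c. (\<forall>j\<in>I. 0 < c $ j) \<and> (\<forall>j. j \<notin> I \<longrightarrow> c $ j = 0)}"
proof safe
  fix c j assume c: "c \<in> rel_interior (coord_face I)" and j: "j \<in> I"
  then have cI: "c \<in> coord_face I" using rel_interior_subset by blast
  obtain e where e: "e > 0" "ball c e \<inter> affine hull (coord_face I) \<subseteq> coord_face I"
    using c mem_rel_interior_ball by blast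
  show "0 < c $ j"
  proof (rule ccontr)
    assume "\<not> 0 < c $ j"
    moreover have "0 \<le> c $ j" using cI by (simp add: coord_face_def)
    ultimately have cj: "c $ j = 0" by simp
    define y where "y = c - (e/2) *\<^sub>R axis j 1"
    have "c + axis j 1 \<in> coord_face I" using cI j by (auto simp: coord_face_def axis_def)
    then have "c - (e/2) *\<^sub>R ((c + axis j 1) - c) \<in> affine hull (coord_face I)"
      using cI by (intro mem_affine_3_minus2 affine_affine_hull hull_inc)
    then have "y \<in> affine hull (coord_face I)" by (simp add: y_def)
    moreover have "y \<in> ball c e" using e(1) by (simp add: y_def dist_norm)
    ultimately have "0 \<le> y $ j" using e(2) by (auto simp: coord_face_def)
    with cj e(1) show False by (simp add: y_def)
  qed
next
  fix c j assume "c \<in> rel_interior (coord_face I)" "j \<notin> I"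
  then show "c $ j = 0" using rel_interior_subset[of "coord_face I"] by (auto simp: coord_face_def)
next
  fix c :: "real ^ 'n" assume pos: "\<forall>j\<in>I. 0 < c $ j" and zero: "\<forall>j. j \<notin> I \<longrightarrow> c $ j = 0"
  have nonneg: "0 \<le> c $ j" for j using pos zero by (cases "j \<in> I") auto
  define e where "e = Min (insert 1 ((\<lambda>j. c $ j) ` I))"
  have "e > 0" unfolding e_def using pos by (subst Min_gr_iff) auto
  have "ball c e \<inter> affine hull (coord_face I) \<subseteq> coord_face I"
  proof
    fix y assume y: "y \<in> ball c e \<inter> affine hull (coord_face I)"
    have y_zero: "\<forall>j. j \<notin> I \<longrightarrow> y $ j = 0" using y affine_hull_coord_face_subset by blast
    have "0 \<le> y $ j" for j
    proof (cases "j \<in> I")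
      case True
      have "e \<le> c $ j" unfolding e_def using True by (intro Min_le) auto
      moreover have "\<bar>(c - y) $ j\<bar> < e"
        using y component_le_norm_cart[of "c - y" j] by (simp add: dist_norm)
      ultimately show ?thesis by simp
    qed (use y_zero in simp)
    with y_zero show "y \<in> coord_face I" by (simp add: coord_face_def)
  qed
  moreover have "c \<in> coord_face I" using nonneg zero by (simp add: coord_face_def)
  ultimately show "c \<in> rel_interior (coord_face I)" using \<open>e > 0\<close> mem_rel_interior_ball by blast
qed

definition gen_matrix :: "('i \<Rightarrow> real ^ 'n) \<Rightarrow> real ^ 'i ^ 'n" where
  "gen_matrix v = (\<chi> i j. v j $ i)"

lemma gen_matrix_mult: "gen_matrix v *v c = (\<Sum>j\<in>UNIV. c $ j *\<^sub>R v j)"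
  by (simp add: matrix_mult_sum scalar_mult_eq_scaleR column_def gen_matrix_def)

lemma gen_matrix_axis: "gen_matrix v *v axis k 1 = v k"
  by (simp add: matrix_vector_mult_basis column_def gen_matrix_def)

lemma vector_gen_matrix_nth: "(f v* gen_matrix v) $ j = v j \<bullet> f"
  by (simp add: vector_matrix_mult_def gen_matrix_def inner_vec_def mult.commute)

lemma invertible_gen_matrix:
  fixes v :: "'n::finite \<Rightarrow> real ^ 'n"
  assumes "independent (range v)" and "inj v"
  shows "invertible (gen_matrix v)"
  unfolding invertible_left_inverse matrix_left_invertible_ker
proof (intro allI impI)
  fix c assume "gen_matrix v *v c = 0"
  then have "(\<Sum>w\<in>range v. c $ inv v w *\<^sub>R w) = 0"
    using \<open>inj v\<close> by (simp add: gen_matrix_mult sum.reindex)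
  then have "c $ inv v (v j) = 0" for j
    using assms(1) by (auto simp: dependent_finite)
  then show "c = 0" using \<open>inj v\<close> by (simp add: vec_eq_iff)
qed

lemma gen_cone_eq_image_coord_face: "gen_cone v = (*v) (gen_matrix v) ` coord_face UNIV"
proof (intro set_eqI iffI)
  fix x assume "x \<in> gen_cone v"
  then obtain c where "x = (\<Sum>i\<in>UNIV. c i *\<^sub>R v i)" "\<forall>i. 0 \<le> c i"
    by (auto simp: gen_cone_def)
  then show "x \<in> (*v) (gen_matrix v) ` coord_face UNIV"
    by (intro image_eqI[where x = "vec_lambda c"]) (simp_all add: gen_matrix_mult coord_face_def)
next
  fix x assume "x \<in> (*v) (gen_matrix v) ` coord_face UNIV"
  then obtain c where "x = gen_matrix v *v c" "c \<in> coord_face UNIV" by blast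
  then show "x \<in> gen_cone v"
    unfolding gen_cone_def gen_matrix_mult coord_face_def by blast
qed

lemma generator_in_gen_cone: "v k \<in> gen_cone v"
proof -
  have "axis k 1 \<in> coord_face UNIV" by (simp add: coord_face_def axis_def)
  then show ?thesis unfolding gen_cone_eq_image_coord_face by (metis gen_matrix_axis image_eqI)
qed

lemma face_of_gen_cone_eq_image_coord_face:
  assumes "cone_face \<gamma> (gen_cone v)"
  obtains I where "\<gamma> = (*v) (gen_matrix v) ` coord_face I"
proof -
  obtain w where w: "w \<in> dual_cone (gen_cone v)" "\<gamma> = gen_cone v \<inter> {x. w \<bullet> x = 0}"
    using assms unfolding cone_face_def by blast
  have w_nonneg: "0 \<le> c $ j * (w \<bullet> v j)" if "c \<in> coord_face UNIV" for c j
    using that w(1) generator_in_gen_cone[of v j] by (simp add: coord_face_def dual_cone_def)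
  have w_eq: "w \<bullet> (gen_matrix v *v c) = (\<Sum>j\<in>UNIV. c $ j * (w \<bullet> v j))" for c
    by (simp add: gen_matrix_mult inner_sum_right)
  have "\<gamma> = (*v) (gen_matrix v) ` coord_face {j. w \<bullet> v j = 0}"
  proof safe
    fix x assume "x \<in> \<gamma>"
    then obtain c where c: "c \<in> coord_face UNIV" "x = gen_matrix v *v c" "w \<bullet> x = 0"
      using w(2) by (auto simp: gen_cone_eq_image_coord_face)
    then have "(\<Sum>j\<in>UNIV. c $ j * (w \<bullet> v j)) = 0" using w_eq by simp
    then have "c $ j * (w \<bullet> v j) = 0" for j
      using sum_nonneg_eq_0_iff[of UNIV "\<lambda>j. c $ j * (w \<bullet> v j)"] w_nonneg[OF c(1)] by simp
    then have "c \<in> coord_face {j. w \<bullet> v j = 0}" using c(1) by (simp add: coord_face_def) meson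
    then show "x \<in> (*v) (gen_matrix v) ` coord_face {j. w \<bullet> v j = 0}" using c(2) by blast
  next
    fix c assume "c \<in> coord_face {j. w \<bullet> v j = 0}"
    then show "gen_matrix v *v c \<in> \<gamma>"
      using w(2) w_eq by (auto simp: gen_cone_eq_image_coord_face coord_face_def intro!: sum.neutral)
  qed
  then show thesis using that by blast
qed

lemma dual_cone_gen_cone: "dual_cone (gen_cone v) = {f. \<forall>j. 0 \<le> v j \<bullet> f}"
proof safe
  fix f j assume "f \<in> dual_cone (gen_cone v)"
  then have "0 \<le> f \<bullet> v j" using generator_in_gen_cone[of v j] by (simp add: dual_cone_def)
  then show "0 \<le> v j \<bullet> f" by (simp add: inner_commute)
next
  fix f assume "\<forall>j. 0 \<le> v j \<bullet> f"
  then have "0 \<le> f \<bullet> v j" for j by (simp add: inner_commute)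
  then show "f \<in> dual_cone (gen_cone v)"
    by (auto simp: dual_cone_def gen_cone_def inner_sum_right intro!: sum_nonneg)
qed

lemma face_star_image_coord_face:
  "face_star (dual_cone (gen_cone v)) ((*v) (gen_matrix v) ` coord_face I) =
     {f. f v* gen_matrix v \<in> coord_face (- I)}"
proof -
  have orth_iff: "f \<in> orth ((*v) (gen_matrix v) ` coord_face I) \<longleftrightarrow> (\<forall>j\<in>I. v j \<bullet> f = 0)" for f
  proof
    assume "f \<in> orth ((*v) (gen_matrix v) ` coord_face I)"
    moreover have "axis j 1 \<in> coord_face I" if "j \<in> I" for j
      using that by (simp add: coord_face_def axis_def)
    ultimately show "\<forall>j\<in>I. v j \<bullet> f = 0"
      by (auto simp: orth_def inner_commute simp flip: gen_matrix_axis)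
  next
    assume "\<forall>j\<in>I. v j \<bullet> f = 0"
    then show "f \<in> orth ((*v) (gen_matrix v) ` coord_face I)"
      by (auto simp: orth_def coord_face_def gen_matrix_mult inner_sum_right inner_commute
          intro!: sum.neutral)
  qed
  then have "face_star (dual_cone (gen_cone v)) ((*v) (gen_matrix v) ` coord_face I) =
      {f. (\<forall>j\<in>I. v j \<bullet> f = 0) \<and> (\<forall>j. 0 \<le> v j \<bullet> f)}"
    by (auto simp: face_star_def dual_cone_gen_cone)
  also have "\<dots> = {f. f v* gen_matrix v \<in> coord_face (- I)}"
    by (auto simp: coord_face_def vector_gen_matrix_nth)
  finally show ?thesis .
qed

(* The signs of b - a for a, b in the relative interiors of coord_face I1 and coord_face I2. *)
definition sign_pattern :: "'n set \<Rightarrow> 'n set \<Rightarrow> real ^ 'n \<Rightarrow> bool" where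
  "sign_pattern I1 I2 c \<longleftrightarrow>
     (\<forall>j. (j \<in> I2 - I1 \<longrightarrow> 0 < c $ j) \<and> (j \<in> I1 - I2 \<longrightarrow> c $ j < 0) \<and>
          (j \<notin> I1 \<union> I2 \<longrightarrow> c $ j = 0))"

lemma sign_pattern_uminus: "sign_pattern I2 I1 (- c) \<longleftrightarrow> sign_pattern I1 I2 c"
  by (auto simp: sign_pattern_def)

lemma sign_pattern_scaleR: "0 < d \<Longrightarrow> sign_pattern I1 I2 (d *\<^sub>R c) \<longleftrightarrow> sign_pattern I1 I2 c"
  by (simp add: sign_pattern_def zero_less_mult_iff mult_less_0_iff)

lemma sign_pattern_inner_coord_face:
  assumes c: "sign_pattern I1 I2 c" and x: "x \<in> coord_face (- I1)"
  shows "0 \<le> c \<bullet> x" and "c \<bullet> x = 0 \<longleftrightarrow> x \<in> coord_face (- I2)"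
proof -
  have terms_nonneg: "0 \<le> c $ j * x $ j" for j
    using c x by (cases "j \<in> I1"; cases "j \<in> I2") (auto simp: sign_pattern_def coord_face_def)
  have inner_eq: "c \<bullet> x = (\<Sum>j\<in>UNIV. c $ j * x $ j)" by (simp add: inner_vec_def)
  then show "0 \<le> c \<bullet> x" using terms_nonneg by (simp add: sum_nonneg)
  have "(\<forall>j. c $ j * x $ j = 0) \<longleftrightarrow> x \<in> coord_face (- I2)"
    using c x by (auto simp: sign_pattern_def coord_face_def) (metis less_irrefl)
  then show "c \<bullet> x = 0 \<longleftrightarrow> x \<in> coord_face (- I2)"
    using inner_eq sum_nonneg_eq_0_iff[of UNIV "\<lambda>j. c $ j * x $ j"] terms_nonneg by simp
qed

lemma separating_form_swap: "separating_form u D1 D2 \<longleftrightarrow> separating_form (- u) D2 D1"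
  by (auto simp: separating_form_def)

lemma separating_form_coord_faces_pos:
  fixes g :: "real ^ 'm \<Rightarrow> real ^ 'n"
  assumes "surj g" and u: "\<And>f. u \<bullet> f = c \<bullet> g f"
    and sep: "separating_form u {f. g f \<in> coord_face (- I1)} {f. g f \<in> coord_face (- I2)}"
    and "k \<in> I2" "k \<notin> I1"
  shows "0 < c $ k"
proof -
  obtain f where f: "g f = axis k 1" using \<open>surj g\<close> by (metis surjD)
  have uf: "u \<bullet> f = c $ k" by (simp add: u f inner_axis)
  have f1: "g f \<in> coord_face (- I1)" using f \<open>k \<notin> I1\<close> by (simp add: coord_face_def axis_def)
  have f2: "g f \<notin> coord_face (- I2)"
  proof
    assume "g f \<in> coord_face (- I2)"
    then have "g f $ k = 0" using \<open>k \<in> I2\<close> by (simp add: coord_face_def)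
    then show False using f by simp
  qed
  have "0 \<le> u \<bullet> f" using sep f1 unfolding separating_form_def by blast
  moreover have "u \<bullet> f \<noteq> 0"
  proof
    assume "u \<bullet> f = 0"
    then have "f \<in> {f. g f \<in> coord_face (- I1)} \<inter> {f. g f \<in> coord_face (- I2)}"
      using sep f1 unfolding separating_form_def by blast
    then show False using f2 by blast
  qed
  ultimately show ?thesis by (simp add: uf)
qed

lemma separating_form_coord_faces_iff:
  fixes g :: "real ^ 'm \<Rightarrow> real ^ 'n"
  assumes "surj g" and u: "\<And>f. u \<bullet> f = c \<bullet> g f"
  shows "separating_form u {f. g f \<in> coord_face (- I1)} {f. g f \<in> coord_face (- I2)}
           \<longleftrightarrow> sign_pattern I1 I2 c"
    (is "separating_form u ?D1 ?D2 \<longleftrightarrow> _")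
proof
  assume sep: "separating_form u ?D1 ?D2"
  have neg_u: "- u \<bullet> f = - c \<bullet> g f" for f by (simp add: u)
  have "0 < c $ k" if "k \<in> I2 - I1" for k
    using separating_form_coord_faces_pos[OF assms sep] that by blast
  moreover have "0 < (- c) $ k" if "k \<in> I1 - I2" for k
    using separating_form_coord_faces_pos[OF \<open>surj g\<close> neg_u separating_form_swap[THEN iffD1, OF sep]]
      that by blast
  moreover have "c $ k = 0" if "k \<notin> I1 \<union> I2" for k
  proof -
    obtain f where f: "g f = axis k 1" using \<open>surj g\<close> by (metis surjD)
    then have "f \<in> ?D1 \<inter> ?D2" using that by (simp add: coord_face_def axis_def)
    then have "u \<bullet> f = 0" using sep unfolding separating_form_def by blast
    then show ?thesis by (simp add: u f inner_axis)
  qed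
  ultimately show "sign_pattern I1 I2 c" by (auto simp: sign_pattern_def)
next
  assume c: "sign_pattern I1 I2 c"
  then have neg_c: "sign_pattern I2 I1 (- c)" by (simp add: sign_pattern_uminus)
  show "separating_form u ?D1 ?D2"
    unfolding separating_form_def
  proof (intro conjI)
    show "\<forall>f\<in>?D1. 0 \<le> u \<bullet> f"
      using sign_pattern_inner_coord_face(1)[OF c] by (simp add: u)
    show "\<forall>f\<in>?D2. u \<bullet> f \<le> 0"
      using sign_pattern_inner_coord_face(1)[OF neg_c] by (simp add: u)
    show "?D1 \<inter> {f. u \<bullet> f = 0} = ?D1 \<inter> ?D2"
      using sign_pattern_inner_coord_face(2)[OF c] by (auto simp: u)
    show "?D2 \<inter> {f. u \<bullet> f = 0} = ?D1 \<inter> ?D2"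
      using sign_pattern_inner_coord_face(2)[OF neg_c] by (auto simp: u)
  qed
qed

lemma rel_interior_image_coord_faces_meet_iff:
  fixes T :: "real ^ 'n ^ 'm"
  shows "rel_interior ((*v) T ` coord_face I1) \<inter> rel_interior ((*v) T ` coord_face I2) \<noteq> {}
           \<longleftrightarrow> (\<exists>c. T *v c = 0 \<and> sign_pattern I1 I2 c)"
proof -
  have rel_interior_image: "rel_interior ((*v) T ` coord_face I) = (*v) T ` rel_interior (coord_face I)"
    for I by (simp add: rel_interior_convex_linear_image convex_coord_face)
  show ?thesis
  proof
    assume "rel_interior ((*v) T ` coord_face I1) \<inter> rel_interior ((*v) T ` coord_face I2) \<noteq> {}"
    then obtain a b where a: "a \<in> rel_interior (coord_face I1)" and b: "b \<in> rel_interior (coord_face I2)"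
      and "T *v a = T *v b"
      unfolding rel_interior_image by blast
    then have "T *v (b - a) = 0" by (simp add: matrix_vector_mult_diff_distrib)
    moreover have "sign_pattern I1 I2 (b - a)"
      using a b by (auto simp: rel_interior_coord_face sign_pattern_def)
    ultimately show "\<exists>c. T *v c = 0 \<and> sign_pattern I1 I2 c" by blast
  next
    assume "\<exists>c. T *v c = 0 \<and> sign_pattern I1 I2 c"
    then obtain c where c: "T *v c = 0" "sign_pattern I1 I2 c" by blast
    define a where
      "a = (\<chi> j. if j \<in> I1 - I2 then - c $ j else if j \<in> I1 then 1 + \<bar>c $ j\<bar> else 0)"
    have a: "a \<in> rel_interior (coord_face I1)"
      using c(2) by (auto simp: a_def rel_interior_coord_face sign_pattern_def)
    have b: "a + c \<in> rel_interior (coord_face I2)"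
      using c(2) by (auto simp: a_def rel_interior_coord_face sign_pattern_def)
    have "T *v (a + c) = T *v a" using c(1) by (simp add: matrix_vector_right_distrib)
    then show "rel_interior ((*v) T ` coord_face I1) \<inter> rel_interior ((*v) T ` coord_face I2) \<noteq> {}"
      unfolding rel_interior_image using a b by (metis IntI empty_iff image_eqI)
  qed
qed

lemma closure_rat_vecs: "closure (rat_vecs :: (real ^ 'n) set) = UNIV"
proof -
  have "\<exists>y\<in>rat_vecs. dist y x < e" if "e > 0" for x :: "real ^ 'n" and e
  proof -
    have "\<forall>i. \<exists>q. q \<in> \<rat> \<and> \<bar>q - x $ i\<bar> < e / CARD('n)"
      using \<open>e > 0\<close> by (metis rational_approximation of_nat_0_less_iff zero_less_card_finite divide_pos_pos)
    then obtain q where q: "\<And>i. q i \<in> \<rat>" "\<And>i. \<bar>q i - x $ i\<bar> < e / CARD('n)" by metis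
    have "dist (vec_lambda q) x \<le> (\<Sum>i\<in>UNIV. \<bar>q i - x $ i\<bar>)"
      using norm_le_l1_cart[of "vec_lambda q - x"] by (simp add: dist_norm)
    also have "\<dots> < (\<Sum>(i::'n)\<in>UNIV. e / CARD('n))" using q(2) by (intro sum_strict_mono) auto
    also have "\<dots> = e" by simp
    finally have "dist (vec_lambda q) x < e" .
    moreover have "vec_lambda q \<in> rat_vecs" using q(1) by (simp add: rat_vecs_def)
    ultimately show ?thesis by blast
  qed
  then show ?thesis by (auto simp: closure_approachable)
qed

lemma inner_rat_vecs: "x \<in> rat_vecs \<Longrightarrow> y \<in> rat_vecs \<Longrightarrow> x \<bullet> y \<in> \<rat>"
  by (auto simp: rat_vecs_def inner_vec_def intro!: Rats_sum Rats_mult)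

lemma eliminate_coordinate_in_orth:
  assumes "a \<in> R" and "a $ p \<noteq> 0"
    and y: "y \<in> orth ((\<lambda>r. r - (r $ p / a $ p) *\<^sub>R a) ` (R - {a}))"
  shows "y - ((y \<bullet> a) / a $ p) *\<^sub>R axis p 1 \<in> orth R"
  unfolding orth_def
proof safe
  fix r assume "r \<in> R"
  have eliminate: "(y - ((y \<bullet> a) / a $ p) *\<^sub>R axis p 1) \<bullet> r = y \<bullet> (r - (r $ p / a $ p) *\<^sub>R a)"
    by (simp add: inner_diff_right inner_diff_left inner_axis')
  show "(y - ((y \<bullet> a) / a $ p) *\<^sub>R axis p 1) \<bullet> r = 0"
  proof (cases "r = a")
    case True
    then show ?thesis using \<open>a $ p \<noteq> 0\<close> by (simp add: inner_diff_left inner_axis')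
  next
    case False
    then show ?thesis using \<open>r \<in> R\<close> y by (auto simp: eliminate orth_def)
  qed
qed

lemma orth_subset_closure_rat_vecs:
  fixes R :: "(real ^ 'n) set"
  assumes "finite R" and "R \<subseteq> rat_vecs"
  shows "orth R \<subseteq> closure (rat_vecs \<inter> orth R)"
  using assms
proof (induction "card R" arbitrary: R rule: less_induct)
  case less
  show ?case
  proof (cases "R \<subseteq> {0}")
    case True
    then have "orth R = UNIV" by (auto simp: orth_def)
    then show ?thesis by (simp add: closure_rat_vecs)
  next
    case False
    then obtain a p where a: "a \<in> R" and ap: "a $ p \<noteq> 0"
      by (metis subset_iff insert_iff vec_eq_iff zero_index)
    \<comment> \<open>Gaussian elimination of the coordinate p by the equation a\<close>
    define elim where "elim y = y - ((y \<bullet> a) / a $ p) *\<^sub>R axis p 1" for y :: "real ^ 'n"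
    define R' where "R' = (\<lambda>r. r - (r $ p / a $ p) *\<^sub>R a) ` (R - {a})"
    have "card R' < card R"
      unfolding R'_def using less.prems(1) a
      by (meson card_Diff1_less card_image_le finite_Diff le_less_trans)
    moreover have "finite R'" using less.prems(1) by (simp add: R'_def)
    moreover have "R' \<subseteq> rat_vecs"
      using less.prems(2) a by (auto simp: R'_def rat_vecs_def subset_iff intro!: Rats_diff Rats_mult Rats_divide)
    ultimately have IH: "orth R' \<subseteq> closure (rat_vecs \<inter> orth R')" by (rule less.hyps)
    have elim_orth: "elim y \<in> orth R" if "y \<in> orth R'" for y
      using a ap that unfolding elim_def R'_def by (rule eliminate_coordinate_in_orth)
    have elim_rat: "elim y \<in> rat_vecs" if "y \<in> rat_vecs" for y
    proof -
      have "a \<in> rat_vecs" using a less.prems(2) by blast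
      then have "y \<bullet> a \<in> \<rat>" and "a $ p \<in> \<rat>" using that by (simp_all add: inner_rat_vecs rat_vecs_def)
      then show ?thesis
        using that by (auto simp: elim_def rat_vecs_def axis_def intro!: Rats_diff Rats_divide)
    qed
    have elim_fix: "elim x = x" if "x \<in> orth R" for x
      using a that by (simp add: elim_def orth_def)
    have "orth R \<subseteq> orth R'"
      using a by (auto simp: orth_def R'_def inner_diff_right)
    show ?thesis
    proof
      fix x assume x: "x \<in> orth R"
      have "continuous_on UNIV elim" unfolding elim_def using ap by (auto intro!: continuous_intros)
      then have "elim x \<in> closure (elim ` (rat_vecs \<inter> orth R'))"
        using IH x \<open>orth R \<subseteq> orth R'\<close> continuous_image_closure_subset by blast
      also have "\<dots> \<subseteq> closure (rat_vecs \<inter> orth R)"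
        using elim_orth elim_rat by (intro closure_mono) blast
      finally show "x \<in> closure (rat_vecs \<inter> orth R)" using elim_fix x by simp
    qed
  qed
qed

lemma rat_vecs_matrix_vector_mult:
  "\<forall>i j. A $ i $ j \<in> \<rat> \<Longrightarrow> x \<in> rat_vecs \<Longrightarrow> A *v x \<in> rat_vecs"
  by (auto simp: rat_vecs_def matrix_vector_mult_def intro!: Rats_sum Rats_mult)

lemma rat_kernel_vector_with_sign_pattern:
  fixes T :: "real ^ 'n ^ 'm"
  assumes T: "\<forall>i j. T $ i $ j \<in> \<rat>" and "T *v c = 0" and "sign_pattern I1 I2 c"
  obtains y where "y \<in> rat_vecs" "T *v y = 0" "sign_pattern I1 I2 y"
proof -
  \<comment> \<open>orth R is defined by rational equations, and the strict sign conditions are open\<close>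
  define R where "R = range (($) T) \<union> (\<lambda>j. axis j 1) ` (- (I1 \<union> I2))"
  have orth_R: "y \<in> orth R \<longleftrightarrow> T *v y = 0 \<and> (\<forall>j. j \<notin> I1 \<union> I2 \<longrightarrow> y $ j = 0)" for y
  proof -
    have "y \<in> orth R \<longleftrightarrow> (\<forall>i. y \<bullet> T $ i = 0) \<and> (\<forall>j. j \<notin> I1 \<union> I2 \<longrightarrow> y \<bullet> axis j 1 = 0)"
      unfolding R_def orth_def by blast
    then show ?thesis by (simp add: vec_eq_iff matrix_vector_mul_component inner_commute inner_axis)
  qed
  define U where "U = (\<Inter>j\<in>I2 - I1. {y :: real ^ 'n. 0 < y $ j}) \<inter> (\<Inter>j\<in>I1 - I2. {y. y $ j < 0})"
  have "open U"
    unfolding U_def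
    by (intro open_Int open_INT) (simp_all add: open_halfspace_component_gt_cart open_halfspace_component_lt_cart)
  have "finite R" "R \<subseteq> rat_vecs" using T by (auto simp: R_def rat_vecs_def axis_def)
  then have "orth R \<subseteq> closure (rat_vecs \<inter> orth R)" by (rule orth_subset_closure_rat_vecs)
  moreover have "c \<in> U \<inter> orth R" using assms by (auto simp: U_def orth_R sign_pattern_def)
  ultimately have "U \<inter> (rat_vecs \<inter> orth R) \<noteq> {}"
    using open_Int_closure_eq_empty[OF \<open>open U\<close>] by blast
  then obtain y where "y \<in> U" "y \<in> rat_vecs" "y \<in> orth R" by blast
  moreover from this have "sign_pattern I1 I2 y" by (auto simp: U_def orth_R sign_pattern_def)
  ultimately show thesis using that orth_R by blast
qed

lemma rat_vecs_scale_to_int_vecs: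
  assumes "x \<in> rat_vecs"
  obtains d :: real where "0 < d" "d *\<^sub>R x \<in> int_vecs"
proof -
  have "\<exists>m::int. 0 < m \<and> of_int m * x $ i \<in> \<int>" for i
  proof -
    have "x $ i \<in> \<rat>" using assms by (simp add: rat_vecs_def)
    then obtain a b :: int where "0 < b" "x $ i = of_int a / of_int b" by (elim Rats_cases')
    then show ?thesis by (intro exI[of _ b]) simp
  qed
  then obtain m where m: "\<And>i. 0 < m i" "\<And>i. of_int (m i) * x $ i \<in> \<int>" by metis
  define d where "d = (\<Prod>i\<in>UNIV. real_of_int (m i))"
  have "d * x $ i \<in> \<int>" for i
  proof -
    have "d = of_int (m i) * (\<Prod>j\<in>UNIV - {i}. real_of_int (m j))"
      unfolding d_def by (rule prod.remove) simp_all
    then have "d * x $ i = (of_int (m i) * x $ i) * (\<Prod>j\<in>UNIV - {i}. real_of_int (m j))"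
      by simp
    then show ?thesis using m(2)[of i] by (metis Ints_mult Ints_of_int of_int_prod)
  qed
  moreover have "0 < d" using m(1) by (simp add: d_def prod_pos)
  ultimately show thesis using that by (simp add: int_vecs_def)
qed

lemma int_vector_in_kernel_with_sign_pattern_iff:
  fixes Q :: "real ^ 'k ^ 'm" and V :: "real ^ 'n ^ 'k"
  assumes Q: "\<forall>i j. Q $ i $ j \<in> \<rat>" and V: "\<forall>i j. V $ i $ j \<in> \<rat>"
  shows "(\<exists>c. V *v c \<in> int_vecs \<and> Q *v (V *v c) = 0 \<and> sign_pattern I1 I2 c) \<longleftrightarrow>
         (\<exists>c. (Q ** V) *v c = 0 \<and> sign_pattern I1 I2 c)"
proof
  assume "\<exists>c. V *v c \<in> int_vecs \<and> Q *v (V *v c) = 0 \<and> sign_pattern I1 I2 c"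
  then show "\<exists>c. (Q ** V) *v c = 0 \<and> sign_pattern I1 I2 c"
    by (auto simp: matrix_vector_mul_assoc)
next
  assume "\<exists>c. (Q ** V) *v c = 0 \<and> sign_pattern I1 I2 c"
  then obtain c where "(Q ** V) *v c = 0" "sign_pattern I1 I2 c" by blast
  moreover have "\<forall>i j. (Q ** V) $ i $ j \<in> \<rat>"
    using Q V by (auto simp: matrix_matrix_mult_def intro!: Rats_sum Rats_mult)
  ultimately obtain y where y: "y \<in> rat_vecs" "(Q ** V) *v y = 0" "sign_pattern I1 I2 y"
    using rat_kernel_vector_with_sign_pattern by blast
  then obtain d where "0 < d" "d *\<^sub>R (V *v y) \<in> int_vecs"
    using rat_vecs_scale_to_int_vecs rat_vecs_matrix_vector_mult[OF V] by blast
  then have "V *v (d *\<^sub>R y) \<in> int_vecs \<and> Q *v (V *v (d *\<^sub>R y)) = 0 \<and> sign_pattern I1 I2 (d *\<^sub>R y)"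
    using y by (simp add: matrix_vector_mult_scaleR matrix_vector_mul_assoc sign_pattern_scaleR)
  then show "\<exists>c. V *v c \<in> int_vecs \<and> Q *v (V *v c) = 0 \<and> sign_pattern I1 I2 c" by blast
qed

lemma perp_annihilator_of_int_kernel_iff:
  fixes Q :: "real ^ 'n ^ 'm"
  assumes Q: "\<forall>i j. Q $ i $ j \<in> \<int>" and u: "u \<in> int_vecs"
  shows "(\<forall>l \<in> {f \<in> int_vecs. \<forall>m \<in> {m \<in> int_vecs. Q *v m = 0}. f \<bullet> m = 0}. u \<bullet> l = 0)
           \<longleftrightarrow> Q *v u = 0"
proof
  assume perp: "\<forall>l \<in> {f \<in> int_vecs. \<forall>m \<in> {m \<in> int_vecs. Q *v m = 0}. f \<bullet> m = 0}. u \<bullet> l = 0"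
  have "Q $ i \<in> {f \<in> int_vecs. \<forall>m \<in> {m \<in> int_vecs. Q *v m = 0}. f \<bullet> m = 0}" for i
    using Q by (auto simp: int_vecs_def simp flip: matrix_vector_mul_component)
  then have "u \<bullet> Q $ i = 0" for i using perp by blast
  then show "Q *v u = 0" by (simp add: vec_eq_iff matrix_vector_mul_component inner_commute)
next
  assume "Q *v u = 0"
  then show "\<forall>l \<in> {f \<in> int_vecs. \<forall>m \<in> {m \<in> int_vecs. Q *v m = 0}. f \<bullet> m = 0}. u \<bullet> l = 0"
    using u by (auto simp: inner_commute)
qed

theorem lemma3p3:
  fixes Qm :: "real ^ 'e ^ 'k" and v :: "'e \<Rightarrow> real ^ 'e"
    and \<gamma>1 \<gamma>2 :: "(real ^ 'e) set"
  assumes Q_int: "\<forall>i j. Qm $ i $ j \<in> \<int>"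
    and v_rat: "\<forall>i. v i \<in> rat_vecs"
    and v_indep: "independent (range v)" and v_inj: "inj v"
    and face1: "cone_face \<gamma>1 (gen_cone v)"
    and face2: "cone_face \<gamma>2 (gen_cone v)"
  defines "\<delta> \<equiv> dual_cone (gen_cone v)"
    and "L \<equiv> {f \<in> int_vecs. \<forall>m \<in> {m \<in> int_vecs. Qm *v m = 0}. f \<bullet> m = 0}"
  shows "(\<exists>u \<in> int_vecs. (\<forall>l\<in>L. u \<bullet> l = 0) \<and>
             separating_form u (face_star \<delta> \<gamma>1) (face_star \<delta> \<gamma>2))
         \<longleftrightarrow> rel_interior ((\<lambda>x. Qm *v x) ` \<gamma>1) \<inter> rel_interior ((\<lambda>x. Qm *v x) ` \<gamma>2) \<noteq> {}"
proof -
  let ?V = "gen_matrix v"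
  have inv: "invertible ?V" using v_indep v_inj by (rule invertible_gen_matrix)
  then have surj_V: "surj ((*v) ?V)" by (simp add: invertible_eq_bij bij_is_surj)
  have "(\<lambda>f. f v* ?V) = (*v) (transpose ?V)" by (simp add: fun_eq_iff)
  then have surj_Vt: "surj (\<lambda>f. f v* ?V)"
    using transpose_invertible[OF inv] by (simp only: invertible_eq_bij bij_is_surj)
  obtain I1 I2 where \<gamma>1: "\<gamma>1 = (*v) ?V ` coord_face I1" and \<gamma>2: "\<gamma>2 = (*v) ?V ` coord_face I2"
    by (meson face_of_gen_cone_eq_image_coord_face face1 face2)
  have sep: "separating_form (?V *v c) (face_star \<delta> \<gamma>1) (face_star \<delta> \<gamma>2) \<longleftrightarrow> sign_pattern I1 I2 c"
    for c unfolding \<delta>_def \<gamma>1 \<gamma>2 face_star_image_coord_face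
    by (rule separating_form_coord_faces_iff[OF surj_Vt]) (metis dot_lmul_matrix inner_commute)
  have L: "(\<forall>l\<in>L. u \<bullet> l = 0) \<longleftrightarrow> Qm *v u = 0" if "u \<in> int_vecs" for u
    unfolding L_def using Q_int that by (rule perp_annihilator_of_int_kernel_iff)
  have "(\<exists>u \<in> int_vecs. (\<forall>l\<in>L. u \<bullet> l = 0) \<and> separating_form u (face_star \<delta> \<gamma>1) (face_star \<delta> \<gamma>2))
      \<longleftrightarrow> (\<exists>c. ?V *v c \<in> int_vecs \<and> Qm *v (?V *v c) = 0 \<and> sign_pattern I1 I2 c)"
    using surj_V L sep unfolding surj_def by (metis (no_types, lifting))
  also have "\<dots> \<longleftrightarrow> (\<exists>c. (Qm ** ?V) *v c = 0 \<and> sign_pattern I1 I2 c)"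
    using Q_int v_rat Ints_subset_Rats
    by (intro int_vector_in_kernel_with_sign_pattern_iff) (auto simp: gen_matrix_def rat_vecs_def)
  also have "\<dots> \<longleftrightarrow> rel_interior ((\<lambda>x. Qm *v x) ` \<gamma>1) \<inter> rel_interior ((\<lambda>x. Qm *v x) ` \<gamma>2) \<noteq> {}"
    unfolding \<gamma>1 \<gamma>2 image_image matrix_vector_mul_assoc
    by (rule rel_interior_image_coord_faces_meet_iff[symmetric])
  finally show ?thesis .
qed

end
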